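(* Let $P\in\mathbb{R}_{>0}^{m\times n}$ be any weight matrix, and for $\alpha\in\mathbb{R}$ let $\ell^*(P,\alpha)$ denote the canonical load of the exponentiated proportional allocation with exponent $\alpha$. Then: (Monotonicity) for all $\alpha_1,\alpha_2\in\mathbb{R}$ with $\alpha_1\ge\alpha_2$, $\ell^*(P,\alpha_1)\ge\ell^*(P,\alpha_2)$; (Convergence) $\lim_{\alpha\to\infty}\ell^*(P,\alpha)=\ell^{\mathrm{SNT}}(P)$ and $\lim_{\alpha\to-\infty}\ell^*(P,\alpha)=\ell^{\mathrm{MKS}}(P)$.
   Context: A feasible allocation is $X=(x_{i,j})\in[0,1]^{m\times n}$ with $\sum_{i}x_{i,j}=1$ for every $j$; the load of agent $i$ is $\ell_i(P,X)=\sum_j p_{i,j}x_{i,j}$. Define $\ell^{\mathrm{SNT}}(P)=\max_X\min_i\ell_i(P,X)$ and $\ell^{\mathrm{MKS}}(P)=\min_X\max_i\ell_i(P,X)$ over feasible $X$. For $\alpha\in\mathbb{R}$ and $\mathbf{w}\in\mathbb{R}_{>0}^m$, the exponentiated proportional (EP) allocation is $x_{i,j}=p_{i,j}^\alpha w_i/\sum_{i'}p_{i',j}^\alpha w_{i'}$. For each $\alpha$ there is a vector $\mathbf{w}^*\in\mathbb{R}_{>0}^m$, unique up to scaling, for which all agents have equal load under the EP-allocation; this common load is the canonical load $\ell^*(P,\alpha)$. *)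

theory Defs imports "HOL-Analysis.Analysis" begin

text \<open>An \<open>m \<times> n\<close> matrix is a \<open>real ^ 'n ^ 'm\<close>: rows are indexed by agents \<open>i :: 'm\<close>, columns by
  items \<open>j :: 'n\<close>.\<close>

definition feasible :: "(real ^ 'n ^ 'm) set" where
  "feasible = {X. (\<forall>i j. 0 \<le> X $ i $ j \<and> X $ i $ j \<le> 1) \<and> (\<forall>j. (\<Sum>i\<in>UNIV. X $ i $ j) = 1)}"

definition agent_load :: "real ^ 'n ^ 'm \<Rightarrow> real ^ 'n ^ 'm \<Rightarrow> 'm \<Rightarrow> real" where
  "agent_load P X i = (\<Sum>j\<in>UNIV. P $ i $ j * X $ i $ j)"

text \<open>The outer optimum ranges over an infinite set. \<open>GREATEST\<close> and \<open>LEAST\<close> denote an attained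
  maximum and minimum, as opposed to \<open>Sup\<close> and \<open>Inf\<close>; they exist here because the feasible set
  is nonempty and compact and the objective is continuous.\<close>

definition snt_load :: "real ^ 'n ^ 'm \<Rightarrow> real" where
  "snt_load P = (GREATEST v. \<exists>X\<in>feasible. v = Min (range (agent_load P X)))"

definition mks_load :: "real ^ 'n ^ 'm \<Rightarrow> real" where
  "mks_load P = (LEAST v. \<exists>X\<in>feasible. v = Max (range (agent_load P X)))"

definition ep_allocation :: "real ^ 'n ^ 'm \<Rightarrow> real \<Rightarrow> real ^ 'm \<Rightarrow> real ^ 'n ^ 'm" where
  "ep_allocation P \<alpha> w =
     (\<chi> i j. (P $ i $ j) powr \<alpha> * w $ i / (\<Sum>i'\<in>UNIV. (P $ i' $ j) powr \<alpha> * w $ i'))"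

definition canonical_weights :: "real ^ 'n ^ 'm \<Rightarrow> real \<Rightarrow> real ^ 'm \<Rightarrow> bool" where
  "canonical_weights P \<alpha> w \<longleftrightarrow>
     (\<forall>i. 0 < w $ i) \<and>
     (\<forall>i i'. agent_load P (ep_allocation P \<alpha> w) i = agent_load P (ep_allocation P \<alpha> w) i')"

text \<open>For positive \<open>P\<close>, canonical weights exist and are unique up to scaling. The allocation is
  invariant under scaling \<open>w\<close>, so the description below determines a unique value.\<close>

definition canonical_load :: "real ^ 'n ^ 'm \<Rightarrow> real \<Rightarrow> real" where
  "canonical_load P \<alpha> =
     (THE l. \<exists>w. canonical_weights P \<alpha> w \<and> (\<forall>i. agent_load P (ep_allocation P \<alpha> w) i = l))"

end

theory Submission imports Defs begin

text \<open>Everything rests on weak duality: for positive multipliers \<open>y\<close>, two allocations are compared by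
  comparing the weighted loads \<open>\<Sum>i. y i * p i j * x i j\<close> column by column. With \<open>q = p * y\<close>, an
  EP-allocation of exponent \<open>\<alpha>\<close> is \<open>x i j \<propto> (q i j) powr \<alpha>\<close> for \<open>y i = (w i) powr (1 / \<alpha>)\<close>, and the
  average of \<open>q\<close> under these weights is, by a power mean inequality, within a factor tending to 1 of
  the maximum (as \<open>\<alpha> \<rightarrow> \<infinity>\<close>) or minimum (as \<open>\<alpha> \<rightarrow> - \<infinity>\<close>) of the column; this gives the limits. Passing from
  \<open>\<alpha>\<^sub>2\<close> to \<open>\<alpha>\<^sub>1 > \<alpha>\<^sub>2\<close> multiplies the allocation, for a suitable \<open>y\<close>, by a function of \<open>q\<close> that is
  increasing within each column, so Chebyshev's sum inequality gives monotonicity. Canonical weights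
  exist by Brouwer's theorem, applied to a map of the simplex that raises the weights of agents with
  below-average load: a vanishing weight has load 0, so at a fixed point nobody is above average.\<close>

section \<open>Inequalities for finite sums\<close>

text \<open>The difference of the two sides is half the double sum over \<open>i\<close> and
  \<open>k\<close> of \<open>c i * c k * ((f i - f k) * (g i - g k))\<close>, whose terms are
  nonnegative. Here \<open>same\<close> says that \<open>f\<close> and \<open>g\<close> are ordered
  alike.\<close>

lemma Chebyshev_sum_weighted:
  fixes c f g :: "'a \<Rightarrow> real"
  assumes c: "\<And>i. i \<in> A \<Longrightarrow> 0 \<le> c i"
    and same: "\<And>i k. i \<in> A \<Longrightarrow> k \<in> A \<Longrightarrow> 0 \<le> (f i - f k) * (g i - g k)"
  shows "(\<Sum>i\<in>A. c i * f i) * (\<Sum>i\<in>A. c i * g i) \<le> (\<Sum>i\<in>A. c i) * (\<Sum>i\<in>A. c i * f i * g i)"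
proof -
  have "0 \<le> (\<Sum>i\<in>A. \<Sum>k\<in>A. c i * c k * ((f i - f k) * (g i - g k)))"
    using c same by (intro sum_nonneg) (auto intro: mult_nonneg_nonneg[OF mult_nonneg_nonneg])
  also have "\<dots> = (\<Sum>i\<in>A. \<Sum>k\<in>A. (c i * f i * g i) * c k + c i * (c k * f k * g k)
        - (c i * f i) * (c k * g k) - (c i * g i) * (c k * f k))"
    by (intro sum.cong refl) (simp add: algebra_simps)
  also have "\<dots> = 2 * ((\<Sum>i\<in>A. c i) * (\<Sum>i\<in>A. c i * f i * g i)
      - (\<Sum>i\<in>A. c i * f i) * (\<Sum>i\<in>A. c i * g i))"
    by (simp only: sum.distrib sum_subtractf sum_product[symmetric]) (simp add: algebra_simps)
  finally show ?thesis by simp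
qed

text \<open>Bounds the largest \<open>q k\<close> by the average of \<open>q\<close> with weights
  \<open>q i powr g\<close>, up to a factor that tends to 1 as \<open>g\<close> grows. Two estimates
  are combined: \<open>q k powr g\<close> is one term of the sum \<open>S\<close>, so
  \<open>q k \<le> S powr (1 / g)\<close>; and Jensen's inequality compares
  \<open>S powr (1 / g) * S\<close> with the sum of the powers \<open>g + 1\<close>.\<close>

lemma mult_powr_sum_le:
  fixes q :: "'a \<Rightarrow> real"
  assumes fin: "finite A" and k: "k \<in> A" and q: "\<And>i. i \<in> A \<Longrightarrow> 0 < q i" and g: "0 < g"
  shows "q k * (\<Sum>i\<in>A. q i powr g) \<le> real (card A) powr (1 / g) * (\<Sum>i\<in>A. q i powr (g + 1))"
proof -
  define n where "n = real (card A)"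
  define S where "S = (\<Sum>i\<in>A. q i powr g)"
  \<comment> \<open>With this exponent \<open>(q i powr g) powr h = q i powr (g + 1)\<close> and
    \<open>S powr h = S * S powr (1 / g)\<close>; it is at least 1, so the power is convex.\<close>
  define h where "h = 1 + 1 / g"
  have n: "0 < n" using fin k unfolding n_def by (metis card_gt_0_iff empty_iff of_nat_0_less_iff)
  have S_ge: "q k powr g \<le> S" unfolding S_def by (rule member_le_sum) (use fin k in auto)
  have qk: "0 < q k powr g" using q[OF k] by simp
  have S: "0 < S" using S_ge qk by linarith
  have h: "1 \<le> h" using g by (simp add: h_def)
  have "(\<Sum>i\<in>A. (1 / n) *\<^sub>R q i powr g) powr h \<le> (\<Sum>i\<in>A. (1 / n) * (q i powr g) powr h)"
    by (rule convex_on_sum[OF fin _ powr_convex[OF h]]) (use n k q in \<open>auto simp: n_def less_imp_neq[THEN not_sym]\<close>)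
  also have "(\<Sum>i\<in>A. (1 / n) *\<^sub>R q i powr g) = S / n"
    by (simp add: S_def sum_divide_distrib)
  also have "(\<Sum>i\<in>A. (1 / n) * (q i powr g) powr h) = (\<Sum>i\<in>A. q i powr (g + 1)) / n"
    using g by (simp add: sum_divide_distrib powr_powr h_def distrib_left)
  finally have "S powr h / n powr h * n \<le> (\<Sum>i\<in>A. q i powr (g + 1))"
    using n S by (simp add: powr_divide field_simps)
  then have "S powr (1 / g) * S \<le> n powr (1 / g) * (\<Sum>i\<in>A. q i powr (g + 1))"
    using n S by (simp add: h_def powr_add field_simps)
  moreover have "q k \<le> S powr (1 / g)"
  proof -
    have "q k = (q k powr g) powr (1 / g)" using g q[OF k] by (simp add: powr_powr)
    also have "\<dots> \<le> S powr (1 / g)" using g qk S_ge by (intro powr_mono2) auto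
    finally show ?thesis .
  qed
  ultimately show ?thesis
    using S mult_right_mono[of "q k" "S powr (1 / g)" S]
    unfolding S_def[symmetric] n_def[symmetric] by linarith
qed

section \<open>The two optima\<close>

lemma continuous_on_Min_image:
  fixes f :: "'a::topological_space \<Rightarrow> 'b \<Rightarrow> real"
  assumes "finite A" "A \<noteq> {}" "\<And>i. i \<in> A \<Longrightarrow> continuous_on S (\<lambda>x. f x i)"
  shows "continuous_on S (\<lambda>x. Min (f x ` A))"
  using assms by (induction A rule: finite_ne_induct) (auto intro!: continuous_on_min)

lemma continuous_on_Max_image:
  fixes f :: "'a::topological_space \<Rightarrow> 'b \<Rightarrow> real"
  assumes "finite A" "A \<noteq> {}" "\<And>i. i \<in> A \<Longrightarrow> continuous_on S (\<lambda>x. f x i)"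
  shows "continuous_on S (\<lambda>x. Max (f x ` A))"
  using assms by (induction A rule: finite_ne_induct) (auto intro!: continuous_on_max)

lemma compact_feasible: "compact (feasible :: (real ^ 'n ^ 'm) set)"
proof -
  have "(feasible :: (real ^ 'n ^ 'm) set) = cbox 0 1 \<inter> (\<Inter>j. {X. (\<Sum>i\<in>UNIV. X $ i $ j) = 1})"
    by (auto simp: feasible_def mem_box_cart cbox_interval less_eq_vec_def)
  moreover have "closed (\<Inter>j. {X :: real ^ 'n ^ 'm. (\<Sum>i\<in>UNIV. X $ i $ j) = 1})"
    by (intro closed_INT ballI closed_Collect_eq continuous_intros)
  ultimately show ?thesis by (metis compact_Int_closed compact_cbox)
qed

lemma feasible_nonempty: "(feasible :: (real ^ 'n ^ 'm) set) \<noteq> {}"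
proof -
  have "(\<chi> i j. 1 / real CARD('m)) \<in> (feasible :: (real ^ 'n ^ 'm) set)"
    by (auto simp: feasible_def)
  then show ?thesis by blast
qed

lemma continuous_on_agent_load: "continuous_on S (\<lambda>X. agent_load P X i)"
  unfolding agent_load_def by (intro continuous_intros)

text \<open>Turns \<open>GREATEST\<close> into an optimal \<open>X\<close> found by compactness; the
  later bounds use only this form. The next lemma does the same for \<open>LEAST\<close>.\<close>

lemma snt_load:
  fixes P :: "real ^ 'n ^ 'm"
  obtains X where "X \<in> feasible" "snt_load P = Min (range (agent_load P X))"
    "\<And>Y. Y \<in> feasible \<Longrightarrow> Min (range (agent_load P Y)) \<le> snt_load P"
proof -
  have "continuous_on feasible (\<lambda>X. Min (range (agent_load P X)))"
    by (intro continuous_on_Min_image continuous_on_agent_load) auto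
  from continuous_attains_sup[OF compact_feasible feasible_nonempty this]
  obtain X where X: "X \<in> feasible"
      "\<And>Y. Y \<in> feasible \<Longrightarrow> Min (range (agent_load P Y)) \<le> Min (range (agent_load P X))"
    by blast
  have "snt_load P = Min (range (agent_load P X))"
    unfolding snt_load_def by (rule Greatest_equality) (use X in auto)
  with X show thesis by (intro that) auto
qed

lemma mks_load:
  fixes P :: "real ^ 'n ^ 'm"
  obtains X where "X \<in> feasible" "mks_load P = Max (range (agent_load P X))"
    "\<And>Y. Y \<in> feasible \<Longrightarrow> mks_load P \<le> Max (range (agent_load P Y))"
proof -
  have "continuous_on feasible (\<lambda>X. Max (range (agent_load P X)))"
    by (intro continuous_on_Max_image continuous_on_agent_load) auto
  from continuous_attains_inf[OF compact_feasible feasible_nonempty this]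
  obtain X where X: "X \<in> feasible"
      "\<And>Y. Y \<in> feasible \<Longrightarrow> Max (range (agent_load P X)) \<le> Max (range (agent_load P Y))"
    by blast
  have "mks_load P = Max (range (agent_load P X))"
    unfolding mks_load_def by (rule Least_equality) (use X in auto)
  with X show thesis by (intro that) auto
qed

text \<open>Weak duality with an approximation factor \<open>c\<close>. The total of the loads
  weighted by \<open>y\<close> is at least \<open>s\<close> times the sum of \<open>y\<close> for
  \<open>X\<close> and at most \<open>t\<close> times that sum for \<open>Y\<close>; exchanging the
  summations splits both totals into columns, where \<open>col\<close> compares them.\<close>

lemma load_le_if_columns_le:
  fixes P X Y :: "real ^ 'n ^ 'm"
  assumes y: "\<And>i. 0 < y i" and c: "0 \<le> c"
    and s: "\<And>i. s \<le> agent_load P X i" and t: "\<And>i. agent_load P Y i \<le> t"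
    and col: "\<And>j. (\<Sum>i\<in>UNIV. P $ i $ j * y i * X $ i $ j) \<le> c * (\<Sum>i\<in>UNIV. P $ i $ j * y i * Y $ i $ j)"
  shows "s \<le> c * t"
proof -
  have swap: "(\<Sum>i\<in>UNIV. y i * agent_load P Z i) = (\<Sum>j\<in>UNIV. \<Sum>i\<in>UNIV. P $ i $ j * y i * Z $ i $ j)"
    for Z :: "real ^ 'n ^ 'm"
    unfolding agent_load_def sum_distrib_left by (subst sum.swap) (simp add: ac_simps)
  have Y: "0 < (\<Sum>i\<in>UNIV. y i)" using y by (intro sum_pos) auto
  have "s * (\<Sum>i\<in>UNIV. y i) \<le> (\<Sum>i\<in>UNIV. y i * agent_load P X i)"
    unfolding sum_distrib_left using y s
    by (intro sum_mono) (metis less_imp_le mult.commute mult_left_mono)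
  also have "\<dots> \<le> (\<Sum>j\<in>UNIV. c * (\<Sum>i\<in>UNIV. P $ i $ j * y i * Y $ i $ j))"
    unfolding swap by (intro sum_mono col)
  also have "\<dots> = c * (\<Sum>i\<in>UNIV. y i * agent_load P Y i)"
    unfolding swap by (rule sum_distrib_left[symmetric])
  also have "\<dots> \<le> c * (\<Sum>i\<in>UNIV. y i * t)"
    using y t c by (intro mult_left_mono sum_mono) (auto simp: less_imp_le)
  also have "\<dots> = c * t * (\<Sum>i\<in>UNIV. y i)" by (simp add: sum_distrib_left ac_simps)
  finally show ?thesis using Y by simp
qed

section \<open>Existence and uniqueness of the canonical load\<close>

lemma ep_allocation_nth:
  "ep_allocation P \<alpha> w $ i $ j =
     (P $ i $ j) powr \<alpha> * w $ i / (\<Sum>i'\<in>UNIV. (P $ i' $ j) powr \<alpha> * w $ i')"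
  by (simp add: ep_allocation_def)

lemma ep_sum_pos:
  fixes P :: "real ^ 'n ^ 'm"
  assumes "\<And>i j. 0 < P $ i $ j" "\<And>i. 0 \<le> w $ i" "0 < (\<Sum>i\<in>UNIV. w $ i)"
  shows "0 < (\<Sum>i\<in>UNIV. (P $ i $ j) powr \<alpha> * w $ i)"
proof -
  obtain k where "0 < w $ k"
    using assms(3) sum_nonpos[of UNIV "\<lambda>i. w $ i"] by (force simp: not_less)
  then have "0 < (P $ k $ j) powr \<alpha> * w $ k" using assms(1)[of k j] by simp
  also have "\<dots> \<le> (\<Sum>i\<in>UNIV. (P $ i $ j) powr \<alpha> * w $ i)"
    using assms by (intro member_le_sum) auto
  finally show ?thesis .
qed

lemma ep_allocation_feasible:
  fixes P :: "real ^ 'n ^ 'm"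
  assumes P: "\<And>i j. 0 < P $ i $ j" and w: "\<And>i. 0 \<le> w $ i" "0 < (\<Sum>i\<in>UNIV. w $ i)"
  shows "ep_allocation P \<alpha> w \<in> feasible"
proof -
  have "(P $ i $ j) powr \<alpha> * w $ i \<le> (\<Sum>i'\<in>UNIV. (P $ i' $ j) powr \<alpha> * w $ i')" for i j
    using w by (intro member_le_sum) auto
  moreover have "(\<Sum>i\<in>UNIV. (P $ i $ j) powr \<alpha> * w $ i) \<noteq> 0" for j
    using ep_sum_pos[OF P w, where j = j and \<alpha> = \<alpha>] by simp
  ultimately show ?thesis
    using w ep_sum_pos[OF P w, where \<alpha> = \<alpha>]
    by (auto simp: feasible_def ep_allocation_nth less_imp_le simp flip: sum_divide_distrib)
qed

lemma canonical_weights_exist: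
  fixes P :: "real ^ 'n ^ 'm"
  assumes P: "\<And>i j. 0 < P $ i $ j"
  obtains w where "canonical_weights P \<alpha> w"
proof -
  define S where "S = {w :: real ^ 'm. (\<forall>i. 0 \<le> w $ i) \<and> (\<Sum>i\<in>UNIV. w $ i) = 1}"
  define L where "L w i = agent_load P (ep_allocation P \<alpha> w) i" for w i
  define avg where "avg w = (\<Sum>i\<in>UNIV. L w i) / real CARD('m)" for w
  \<comment> \<open>The deficits below the average load. The map \<open>f\<close> adds them to the
    weights and rescales to total 1.\<close>
  define e where "e w i = max 0 (avg w - L w i)" for w i
  define f :: "real ^ 'm \<Rightarrow> real ^ 'm"
    where "f w = (\<chi> i. (w $ i + e w i) / (1 + (\<Sum>k\<in>UNIV. e w k)))" for w
  have den: "0 < (\<Sum>i\<in>UNIV. (P $ i $ j) powr \<alpha> * w $ i)" if "w \<in> S" for w j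
    using that P by (intro ep_sum_pos) (auto simp: S_def)
  have e_nonneg: "0 \<le> e w i" for w i by (simp add: e_def)
  have D_pos: "0 < 1 + (\<Sum>k\<in>UNIV. e w k)" for w
    using sum_nonneg[of UNIV "e w"] e_nonneg by (simp add: add_pos_nonneg)
  have contL: "continuous_on S (\<lambda>w. L w i)" for i
    unfolding L_def agent_load_def ep_allocation_nth
    by (intro continuous_intros ballI) (use den in \<open>simp add: less_imp_neq[THEN not_sym]\<close>)
  have "continuous_on S f"
    unfolding f_def e_def avg_def
    by (intro continuous_intros contL ballI)
       (use D_pos in \<open>auto simp: e_def avg_def less_imp_neq[THEN not_sym]\<close>)
  moreover have "f w \<in> S" if "w \<in> S" for w
  proof -
    have "(\<Sum>i\<in>UNIV. f w $ i) = (\<Sum>i\<in>UNIV. w $ i + e w i) / (1 + (\<Sum>k\<in>UNIV. e w k))"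
      by (simp add: f_def sum_divide_distrib)
    also have "\<dots> = 1" using that D_pos[of w] by (simp add: S_def sum.distrib)
    finally show ?thesis
      using that e_nonneg D_pos[of w] by (auto simp: S_def f_def less_imp_le)
  qed
  moreover have "compact S"
  proof -
    have "w $ i \<le> 1" if "w \<in> S" for w i
      using that member_le_sum[of i UNIV "\<lambda>i. w $ i"] by (auto simp: S_def)
    then have "S = cbox 0 1 \<inter> {w. (\<Sum>i\<in>UNIV. w $ i) = 1}"
      by (auto simp: S_def mem_box_cart)
    moreover have "closed {w :: real ^ 'm. (\<Sum>i\<in>UNIV. w $ i) = 1}"
      by (intro closed_Collect_eq continuous_intros)
    ultimately show ?thesis by (simp add: compact_Int_closed)
  qed
  moreover have "convex S"
    by (auto simp: convex_def S_def sum.distrib simp flip: sum_distrib_left)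
  moreover have "(\<chi> i. 1 / real CARD('m)) \<in> S" by (auto simp: S_def)
  ultimately obtain w where w: "w \<in> S" "f w = w"
    using brouwer[of S f] by (metis (no_types, lifting) Pi_I empty_iff)
  define D where "D = (\<Sum>k\<in>UNIV. e w k)"
  \<comment> \<open>At a fixed point the deficits are proportional to the weights, with the total
    deficit \<open>D\<close> as the factor.\<close>
  have wD: "w $ i * D = e w i" for i
  proof -
    have "w $ i = (w $ i + e w i) / (1 + D)"
      using arg_cong[OF w(2), of "\<lambda>v. v $ i"] by (simp add: f_def D_def)
    then show ?thesis using D_pos[of w] by (simp add: D_def field_simps)
  qed
  have L_nonneg: "0 \<le> L w i" for i
    using P w den[OF w(1)] unfolding L_def agent_load_def ep_allocation_nth
    by (intro sum_nonneg mult_nonneg_nonneg divide_nonneg_nonneg) (auto simp: S_def less_imp_le)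
  have L0: "L w i = 0" if "w $ i = 0" for i
    using that by (simp add: L_def agent_load_def ep_allocation_nth)
  have Lpos: "0 < L w i" if "0 < w $ i" for i
  proof -
    have "0 < P $ i $ j * ((P $ i $ j) powr \<alpha> * w $ i / (\<Sum>k\<in>UNIV. (P $ k $ j) powr \<alpha> * w $ k))" for j
      using P[of i j] that den[OF w(1), of j] by simp
    then show ?thesis unfolding L_def agent_load_def ep_allocation_nth by (intro sum_pos) auto
  qed
  obtain k where "0 < w $ k"
    using w(1) sum_nonpos[of UNIV "\<lambda>i. w $ i"] by (force simp: S_def not_less)
  then have avg_pos: "0 < avg w"
    unfolding avg_def using Lpos L_nonneg by (intro divide_pos_pos sum_pos2[of UNIV k]) auto
  \<comment> \<open>Used twice: an agent below average forces another above it, and once nobody is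
    below average all loads are equal.\<close>
  have dev: "(\<Sum>i\<in>UNIV. L w i - avg w) = 0"
    by (simp add: sum_subtractf avg_def)
  \<comment> \<open>Otherwise \<open>D\<close> is nonzero while some agent \<open>k\<close> above
    average has deficit 0. Then \<open>wD\<close> gives \<open>k\<close> weight 0, hence load 0,
    although its load exceeds a positive average.\<close>
  have ge: "avg w \<le> L w i" for i
  proof (rule ccontr)
    assume less: "\<not> avg w \<le> L w i"
    have "\<exists>k. avg w < L w k"
    proof (rule ccontr)
      assume "\<not> (\<exists>k. avg w < L w k)"
      then have "(\<Sum>k\<in>UNIV. L w k - avg w) < (\<Sum>k\<in>(UNIV :: 'm set). 0)"
        using less by (intro sum_strict_mono_ex1) (auto simp: not_less not_le)
      with dev show False by simp
    qed
    then obtain k where k: "avg w < L w k" by blast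
    have "0 < e w i" using less by (simp add: e_def)
    then have "D \<noteq> 0" using wD[of i] by auto
    moreover have "e w k = 0" using k by (simp add: e_def)
    ultimately have "w $ k = 0" using wD[of k] by simp
    with L0 k avg_pos show False by fastforce
  qed
  have "L w i = avg w" for i
    using dev ge sum_nonneg_eq_0_iff[of UNIV "\<lambda>k. L w k - avg w"] by auto
  moreover have "0 < w $ i" for i
    using L0[of i] ge[of i] avg_pos w(1) by (cases "w $ i = 0") (auto simp: S_def less_le)
  ultimately have "canonical_weights P \<alpha> w"
    by (simp add: canonical_weights_def L_def)
  then show thesis by (rule that)
qed

text \<open>Consider an agent \<open>i\<close> for which \<open>v $ i / w $ i\<close> is largest.
  Passing from \<open>w\<close> to \<open>v\<close> does not lower its share of any column, so its
  load does not drop. Exchanging \<open>w\<close> and \<open>v\<close> then shows that the common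
  load is unique, which is all that \<open>THE\<close> requires.\<close>

lemma equal_ep_load_le:
  fixes P :: "real ^ 'n ^ 'm"
  assumes P: "\<And>i j. 0 < P $ i $ j"
    and w: "\<And>i. 0 < w $ i" "\<And>i. agent_load P (ep_allocation P \<alpha> w) i = l"
    and v: "\<And>i. 0 < v $ i" "\<And>i. agent_load P (ep_allocation P \<alpha> v) i = l'"
  shows "l \<le> l'"
proof -
  have "Max (range (\<lambda>k. v $ k / w $ k)) \<in> range (\<lambda>k. v $ k / w $ k)"
    by (intro Max_in) auto
  then obtain i where "Max (range (\<lambda>k. v $ k / w $ k)) = v $ i / w $ i" by blast
  then have i: "v $ k / w $ k \<le> v $ i / w $ i" for k
    using Max_ge[of "range (\<lambda>k. v $ k / w $ k)" "v $ k / w $ k"] by simp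
  have "ep_allocation P \<alpha> w $ i $ j \<le> ep_allocation P \<alpha> v $ i $ j" for j
  proof -
    \<comment> \<open>After \<open>w\<close> is scaled by \<open>c\<close>, agent \<open>i\<close>
      has the same weight in both vectors and no other agent has more in \<open>v\<close>, so only
      the denominator can shrink.\<close>
    define c where "c = v $ i / w $ i"
    have c: "0 < c" using v w by (simp add: c_def)
    have vi: "v $ i = c * w $ i" using w(1)[of i] by (simp add: c_def)
    have vk: "v $ k \<le> c * w $ k" for k
      using i[of k] w(1)[of k] by (simp add: c_def[symmetric] pos_divide_le_eq)
    have pos: "0 < (\<Sum>k\<in>UNIV. (P $ k $ j) powr \<alpha> * v $ k)"
      using P v by (intro ep_sum_pos) (auto simp: less_imp_le intro: sum_pos)
    have "(\<Sum>k\<in>UNIV. (P $ k $ j) powr \<alpha> * v $ k) \<le> (\<Sum>k\<in>UNIV. (P $ k $ j) powr \<alpha> * (c * w $ k))"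
      using vk by (intro sum_mono mult_left_mono) auto
    also have "\<dots> = c * (\<Sum>k\<in>UNIV. (P $ k $ j) powr \<alpha> * w $ k)"
      by (simp add: sum_distrib_left ac_simps)
    finally have "(P $ i $ j) powr \<alpha> * v $ i / (c * (\<Sum>k\<in>UNIV. (P $ k $ j) powr \<alpha> * w $ k))
        \<le> (P $ i $ j) powr \<alpha> * v $ i / (\<Sum>k\<in>UNIV. (P $ k $ j) powr \<alpha> * v $ k)"
      using pos v(1)[of i] by (intro divide_left_mono) auto
    then show ?thesis using c by (simp add: ep_allocation_nth vi)
  qed
  then have "agent_load P (ep_allocation P \<alpha> w) i \<le> agent_load P (ep_allocation P \<alpha> v) i"
    using P unfolding agent_load_def by (intro sum_mono mult_left_mono) (auto simp: less_imp_le)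
  then show ?thesis using w v by simp
qed

lemma canonical_load:
  fixes P :: "real ^ 'n ^ 'm"
  assumes P: "\<And>i j. 0 < P $ i $ j"
  obtains w where "\<And>i. 0 < w $ i"
    "\<And>i. agent_load P (ep_allocation P \<alpha> w) i = canonical_load P \<alpha>"
    "ep_allocation P \<alpha> w \<in> feasible"
proof -
  obtain v where v: "canonical_weights P \<alpha> v" using canonical_weights_exist[OF P] .
  have "\<exists>!l. \<exists>w. canonical_weights P \<alpha> w \<and> (\<forall>i. agent_load P (ep_allocation P \<alpha> w) i = l)"
  proof (rule ex_ex1I)
    show "\<exists>l w. canonical_weights P \<alpha> w \<and> (\<forall>i. agent_load P (ep_allocation P \<alpha> w) i = l)"
      using v unfolding canonical_weights_def by blast
  next
    fix l l'
    assume "\<exists>w. canonical_weights P \<alpha> w \<and> (\<forall>i. agent_load P (ep_allocation P \<alpha> w) i = l)"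
      and "\<exists>w. canonical_weights P \<alpha> w \<and> (\<forall>i. agent_load P (ep_allocation P \<alpha> w) i = l')"
    then show "l = l'"
      unfolding canonical_weights_def by (meson P equal_ep_load_le order.antisym)
  qed
  from theI'[OF this] obtain w where w: "canonical_weights P \<alpha> w"
    "\<forall>i. agent_load P (ep_allocation P \<alpha> w) i = canonical_load P \<alpha>"
    unfolding canonical_load_def by blast
  moreover have "ep_allocation P \<alpha> w \<in> feasible"
    using w P unfolding canonical_weights_def
    by (intro ep_allocation_feasible) (auto simp: less_imp_le intro: sum_pos)
  ultimately show thesis by (intro that) (auto simp: canonical_weights_def)
qed

section \<open>Monotonicity and limits\<close>

lemma canonical_load_mono:
  fixes P :: "real ^ 'n ^ 'm"
  assumes P: "\<And>i j. 0 < P $ i $ j" and less: "a < b"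
  shows "canonical_load P a \<le> canonical_load P b"
proof -
  obtain u where u: "\<And>i. 0 < u $ i"
    "\<And>i. agent_load P (ep_allocation P a u) i = canonical_load P a"
    using canonical_load[OF P] by metis
  obtain v where v: "\<And>i. 0 < v $ i"
    "\<And>i. agent_load P (ep_allocation P b v) i = canonical_load P b"
    using canonical_load[OF P] by metis
  \<comment> \<open>Chosen so that the change of the unnormalized shares, by the factor
    \<open>P $ i $ j powr (b - a) * (v $ i / u $ i)\<close>, becomes \<open>q i powr (b - a)\<close>
    with \<open>q i = P $ i $ j * y i\<close>: the same increasing function of \<open>q\<close> in
    every column.\<close>
  define y where "y i = (v $ i / u $ i) powr (1 / (b - a))" for i
  have y: "0 < y i" for i using u(1)[of i] v(1)[of i] by (simp add: y_def)
  have "canonical_load P a \<le> 1 * canonical_load P b"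
  proof (rule load_le_if_columns_le[OF y])
    fix j
    define c where "c i = (P $ i $ j) powr a * u $ i" for i
    define d where "d i = (P $ i $ j) powr b * v $ i" for i
    define q where "q i = P $ i $ j * y i" for i
    have q: "0 < q i" for i using P y by (simp add: q_def)
    have c: "0 < c i" for i using P[of i j] u by (simp add: c_def)
    have d: "0 < d i" for i using P[of i j] v by (simp add: d_def)
    have cd: "c i * q i powr (b - a) = d i" for i
    proof -
      have "q i powr (b - a) = (P $ i $ j) powr (b - a) * (v $ i / u $ i)"
        using P[of i j] y[of i] less u(1)[of i] v(1)[of i]
        by (simp add: q_def powr_mult y_def powr_powr)
      then show ?thesis
        using P[of i j] u(1)[of i] by (simp add: c_def d_def powr_diff)
    qed
    have "(\<Sum>i\<in>UNIV. c i * q i) * (\<Sum>i\<in>UNIV. c i * q i powr (b - a))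
        \<le> (\<Sum>i\<in>UNIV. c i) * (\<Sum>i\<in>UNIV. c i * q i * q i powr (b - a))"
    proof (rule Chebyshev_sum_weighted)
      fix i k
      show "0 \<le> (q i - q k) * (q i powr (b - a) - q k powr (b - a))"
        using less q[of i] q[of k] powr_mono2[of "b - a" "q i" "q k"] powr_mono2[of "b - a" "q k" "q i"]
        by (cases "q i \<le> q k") (simp_all add: mult_nonpos_nonpos)
    qed (use c in \<open>auto simp: less_imp_le\<close>)
    also have "(\<Sum>i\<in>UNIV. c i * q i * q i powr (b - a)) = (\<Sum>i\<in>UNIV. q i * d i)"
      by (intro sum.cong refl) (simp add: cd[symmetric])
    \<comment> \<open>Chebyshev's inequality, divided by both normalizing sums: the average of
      \<open>q\<close> in the column is no larger under exponent \<open>a\<close> than under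
      \<open>b\<close>.\<close>
    finally have "(\<Sum>i\<in>UNIV. q i * c i) / (\<Sum>i\<in>UNIV. c i) \<le> (\<Sum>i\<in>UNIV. q i * d i) / (\<Sum>i\<in>UNIV. d i)"
      using c d by (simp add: cd sum_pos pos_divide_le_eq pos_le_divide_eq ac_simps)
    then show "(\<Sum>i\<in>UNIV. P $ i $ j * y i * ep_allocation P a u $ i $ j)
        \<le> 1 * (\<Sum>i\<in>UNIV. P $ i $ j * y i * ep_allocation P b v $ i $ j)"
      by (simp add: ep_allocation_nth c_def d_def q_def sum_divide_distrib)
  qed (use u v in auto)
  then show ?thesis by simp
qed

text \<open>Absorbing the weights into \<open>q\<close> makes the shares proportional to
  \<open>q i powr \<alpha>\<close>, so the column average of \<open>q\<close> is a ratio of power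
  sums whose exponents differ by 1.\<close>

lemma ep_column_sum:
  fixes P :: "real ^ 'n ^ 'm"
  assumes P: "\<And>i j. 0 < P $ i $ j" and w: "\<And>i. 0 < w $ i" and \<alpha>: "\<alpha> \<noteq> 0"
    and q: "\<And>i. q i = P $ i $ j * w $ i powr (1 / \<alpha>)"
  shows "(\<Sum>i\<in>UNIV. q i * ep_allocation P \<alpha> w $ i $ j)
    = (\<Sum>i\<in>UNIV. q i powr (\<alpha> + 1)) / (\<Sum>i\<in>UNIV. q i powr \<alpha>)"
proof -
  have "q i powr \<alpha> = P $ i $ j powr \<alpha> * w $ i" for i
    using P[of i j] w[of i] \<alpha> by (simp add: q powr_mult powr_powr)
  moreover have "q i powr (\<alpha> + 1) = q i * q i powr \<alpha>" for i
    using P[of i j] w[of i] by (simp add: q powr_add)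
  ultimately show ?thesis by (simp add: ep_allocation_nth sum_divide_distrib)
qed

text \<open>A column of a feasible \<open>X\<close> is a probability vector, so the sum is an
  average of \<open>q\<close>.\<close>

lemma feasible_column_average:
  assumes "X \<in> feasible"
  shows "(\<And>i. q i \<le> b) \<Longrightarrow> (\<Sum>i\<in>UNIV. q i * X $ i $ j) \<le> b"
    and "(\<And>i. b \<le> q i) \<Longrightarrow> b \<le> (\<Sum>i\<in>UNIV. q i * X $ i $ j)"
proof -
  have X: "0 \<le> X $ i $ j" "(\<Sum>i\<in>UNIV. b * X $ i $ j) = b" for i
    using assms by (auto simp: feasible_def simp flip: sum_distrib_left)
  show "(\<Sum>i\<in>UNIV. q i * X $ i $ j) \<le> b" if "\<And>i. q i \<le> b"
    using sum_mono[of UNIV "\<lambda>i. q i * X $ i $ j" "\<lambda>i. b * X $ i $ j"] X that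
    by (simp add: mult_right_mono)
  show "b \<le> (\<Sum>i\<in>UNIV. q i * X $ i $ j)" if "\<And>i. b \<le> q i"
    using sum_mono[of UNIV "\<lambda>i. b * X $ i $ j" "\<lambda>i. q i * X $ i $ j"] X that
    by (simp add: mult_right_mono)
qed

text \<open>The first bound holds because the canonical allocation is feasible and its minimum load
  is the canonical load. For the second, an optimal \<open>X\<close> averages \<open>q\<close> in
  each column to at most its maximum, and \<open>mult_powr_sum_le\<close> bounds that by the
  canonical allocation's average; weak duality carries this over to the loads.\<close>

lemma snt_load_bounds:
  fixes P :: "real ^ 'n ^ 'm"
  assumes P: "\<And>i j. 0 < P $ i $ j" and \<alpha>: "0 < \<alpha>"
  shows "canonical_load P \<alpha> \<le> snt_load P"
    and "snt_load P \<le> real CARD('m) powr (1 / \<alpha>) * canonical_load P \<alpha>"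
proof -
  obtain w where w: "\<And>i. 0 < w $ i"
    "\<And>i. agent_load P (ep_allocation P \<alpha> w) i = canonical_load P \<alpha>"
    "ep_allocation P \<alpha> w \<in> feasible"
    using canonical_load[OF P] by metis
  obtain X where X: "X \<in> feasible" "snt_load P = Min (range (agent_load P X))"
    "\<And>Y. Y \<in> feasible \<Longrightarrow> Min (range (agent_load P Y)) \<le> snt_load P"
    using snt_load by metis
  show "canonical_load P \<alpha> \<le> snt_load P" using X(3)[OF w(3)] w(2) by simp
  define y where "y i = w $ i powr (1 / \<alpha>)" for i
  show "snt_load P \<le> real CARD('m) powr (1 / \<alpha>) * canonical_load P \<alpha>"
  proof (rule load_le_if_columns_le)
    show "0 < y i" for i using w(1)[of i] by (simp add: y_def)
    show "snt_load P \<le> agent_load P X i" for i by (simp add: X(2))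
    show "agent_load P (ep_allocation P \<alpha> w) i \<le> canonical_load P \<alpha>" for i by (simp add: w)
    fix j
    define q where "q i = P $ i $ j * y i" for i
    have q: "0 < q i" for i using P w(1)[of i] by (simp add: q_def y_def)
    have "q k \<le> real CARD('m) powr (1 / \<alpha>) * ((\<Sum>i\<in>UNIV. q i powr (\<alpha> + 1)) / (\<Sum>i\<in>UNIV. q i powr \<alpha>))" for k
    proof -
      have "0 < (\<Sum>i\<in>UNIV. q i powr \<alpha>)"
        using q by (intro sum_pos) (auto simp: less_imp_neq[THEN not_sym])
      then show ?thesis
        using mult_powr_sum_le[of UNIV k q \<alpha>] q \<alpha> by (simp add: pos_le_divide_eq)
    qed
    then have "(\<Sum>i\<in>UNIV. q i * X $ i $ j)
        \<le> real CARD('m) powr (1 / \<alpha>) * (\<Sum>i\<in>UNIV. q i * ep_allocation P \<alpha> w $ i $ j)"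
      using ep_column_sum[of P w \<alpha> q j] P w \<alpha> q_def y_def
      by (intro feasible_column_average[OF X(1)]) auto
    then show "(\<Sum>i\<in>UNIV. P $ i $ j * y i * X $ i $ j)
        \<le> real CARD('m) powr (1 / \<alpha>) * (\<Sum>i\<in>UNIV. P $ i $ j * y i * ep_allocation P \<alpha> w $ i $ j)"
      by (simp add: q_def)
  qed simp
qed

text \<open>The mirror image: the canonical allocation is now on the smaller side of weak duality,
  and its column average of \<open>q\<close> is compared with the column minimum.\<close>

lemma mks_load_bounds:
  fixes P :: "real ^ 'n ^ 'm"
  assumes P: "\<And>i j. 0 < P $ i $ j" and \<alpha>: "\<alpha> < - 1"
  shows "mks_load P \<le> canonical_load P \<alpha>"
    and "canonical_load P \<alpha> \<le> real CARD('m) powr (1 / (- \<alpha> - 1)) * mks_load P"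
proof -
  obtain w where w: "\<And>i. 0 < w $ i"
    "\<And>i. agent_load P (ep_allocation P \<alpha> w) i = canonical_load P \<alpha>"
    "ep_allocation P \<alpha> w \<in> feasible"
    using canonical_load[OF P] by metis
  obtain X where X: "X \<in> feasible" "mks_load P = Max (range (agent_load P X))"
    "\<And>Y. Y \<in> feasible \<Longrightarrow> mks_load P \<le> Max (range (agent_load P Y))"
    using mks_load by metis
  show "mks_load P \<le> canonical_load P \<alpha>" using X(3)[OF w(3)] w(2) by simp
  define y where "y i = w $ i powr (1 / \<alpha>)" for i
  define C where "C = real CARD('m) powr (1 / (- \<alpha> - 1))"
  have C: "0 < C" by (simp add: C_def)
  show "canonical_load P \<alpha> \<le> C * mks_load P"
  proof (rule load_le_if_columns_le)
    show "0 < y i" for i using w(1)[of i] by (simp add: y_def)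
    show "agent_load P X i \<le> mks_load P" for i by (simp add: X(2))
    show "canonical_load P \<alpha> \<le> agent_load P (ep_allocation P \<alpha> w) i" for i by (simp add: w)
    fix j
    define q where "q i = P $ i $ j * y i" for i
    have q: "0 < q i" for i using P w(1)[of i] by (simp add: q_def y_def)
    have "(\<Sum>i\<in>UNIV. q i powr (\<alpha> + 1)) / (\<Sum>i\<in>UNIV. q i powr \<alpha>) / C \<le> q k" for k
    proof -
      have "0 < (\<Sum>i\<in>UNIV. q i powr \<alpha>)"
        using q by (intro sum_pos) (auto simp: less_imp_neq[THEN not_sym])
      \<comment> \<open>The power inequality is applied to the reciprocals, turning minimum into
        maximum. Its exponent \<open>g = - \<alpha> - 1\<close> makes \<open>g\<close> and
        \<open>g + 1\<close> correspond to \<open>\<alpha> + 1\<close> and \<open>\<alpha>\<close>,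
        and \<open>g > 0\<close> is the condition \<open>\<alpha> < - 1\<close>.\<close>
      moreover have "inverse (q i) powr (- \<alpha> - 1) = q i powr (\<alpha> + 1)"
        "inverse (q i) powr (- \<alpha> - 1 + 1) = q i powr \<alpha>" for i
        using q[of i] by (simp_all add: inverse_powr powr_minus[symmetric] add.commute)
      ultimately show ?thesis
        using mult_powr_sum_le[of UNIV k "\<lambda>i. inverse (q i)" "- \<alpha> - 1"] q \<alpha> C
        by (simp add: C_def[symmetric] field_simps)
    qed
    then have "(\<Sum>i\<in>UNIV. q i * ep_allocation P \<alpha> w $ i $ j) / C \<le> (\<Sum>i\<in>UNIV. q i * X $ i $ j)"
      using ep_column_sum[of P w \<alpha> q j] P w \<alpha> q_def y_def
      by (intro feasible_column_average[OF X(1)]) auto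
    then show "(\<Sum>i\<in>UNIV. P $ i $ j * y i * ep_allocation P \<alpha> w $ i $ j)
        \<le> C * (\<Sum>i\<in>UNIV. P $ i $ j * y i * X $ i $ j)"
      using C by (simp add: q_def pos_divide_le_eq mult.commute)
  qed (use C in simp)
qed

theorem theorem2p3:
  fixes P :: "real ^ 'n ^ 'm"
  assumes "\<forall>i j. 0 < P $ i $ j"
  shows "(\<forall>\<alpha>\<^sub>1 \<alpha>\<^sub>2. \<alpha>\<^sub>1 \<ge> \<alpha>\<^sub>2 \<longrightarrow> canonical_load P \<alpha>\<^sub>1 \<ge> canonical_load P \<alpha>\<^sub>2) \<and>
    (canonical_load P \<longlongrightarrow> snt_load P) at_top \<and>
    (canonical_load P \<longlongrightarrow> mks_load P) at_bot"
proof (intro conjI allI impI)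
  have P: "\<And>i j. 0 < P $ i $ j" using assms by blast
  define m where "m = real CARD('m)"
  have m: "0 < m" by (simp add: m_def)
  show "canonical_load P \<alpha>\<^sub>1 \<ge> canonical_load P \<alpha>\<^sub>2" if "\<alpha>\<^sub>1 \<ge> \<alpha>\<^sub>2" for \<alpha>\<^sub>1 \<alpha>\<^sub>2
    using that canonical_load_mono[OF P, of \<alpha>\<^sub>2 \<alpha>\<^sub>1] by (cases "\<alpha>\<^sub>1 = \<alpha>\<^sub>2") auto
  show "(canonical_load P \<longlongrightarrow> snt_load P) at_top"
  \<comment> \<open>The number of agents \<open>m\<close> is fixed, so
    \<open>m powr (1 / \<alpha>)\<close> tends to 1 and both bounds meet at
    \<open>snt_load P\<close>.\<close>
  proof (rule tendsto_sandwich)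
    show "\<forall>\<^sub>F \<alpha> in at_top. snt_load P / m powr (1 / \<alpha>) \<le> canonical_load P \<alpha>"
      using eventually_gt_at_top[of 0]
      by eventually_elim (use snt_load_bounds(2)[OF P] m in \<open>simp add: m_def pos_divide_le_eq mult.commute\<close>)
    show "\<forall>\<^sub>F \<alpha> in at_top. canonical_load P \<alpha> \<le> snt_load P"
      using eventually_gt_at_top[of 0] by eventually_elim (rule snt_load_bounds(1)[OF P])
    have "((\<lambda>\<alpha>. 1 / \<alpha>) \<longlongrightarrow> (0::real)) at_top"
      by (intro tendsto_divide_0[OF tendsto_const] filterlim_at_top_imp_at_infinity filterlim_ident)
    then have "((\<lambda>\<alpha>. snt_load P / m powr (1 / \<alpha>)) \<longlongrightarrow> snt_load P / m powr 0) at_top"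
      using m by (intro tendsto_intros) auto
    then show "((\<lambda>\<alpha>. snt_load P / m powr (1 / \<alpha>)) \<longlongrightarrow> snt_load P) at_top" using m by simp
  qed simp
  show "(canonical_load P \<longlongrightarrow> mks_load P) at_bot"
  proof (rule tendsto_sandwich)
    show "\<forall>\<^sub>F \<alpha> in at_bot. mks_load P \<le> canonical_load P \<alpha>"
      using eventually_gt_at_bot[of "- 1"] by eventually_elim (rule mks_load_bounds(1)[OF P])
    show "\<forall>\<^sub>F \<alpha> in at_bot. canonical_load P \<alpha> \<le> m powr (1 / (- \<alpha> - 1)) * mks_load P"
      using eventually_gt_at_bot[of "- 1"] unfolding m_def
      by eventually_elim (rule mks_load_bounds(2)[OF P])
    \<comment> \<open>The exponent is written as a sum with a constant to fit the limit rule for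
      sums; its reciprocal tends to 0, so the factor again tends to 1.\<close>
    have "filterlim (\<lambda>\<alpha>::real. - 1 + - \<alpha>) at_top at_bot"
      by (intro filterlim_tendsto_add_at_top[OF tendsto_const] filterlim_uminus_at_top_at_bot)
    then have "((\<lambda>\<alpha>::real. 1 / (- 1 + - \<alpha>)) \<longlongrightarrow> 0) at_bot"
      by (intro tendsto_divide_0[OF tendsto_const] filterlim_at_top_imp_at_infinity)
    then have "((\<lambda>\<alpha>::real. 1 / (- \<alpha> - 1)) \<longlongrightarrow> 0) at_bot"
      by (simp add: algebra_simps)
    then have "((\<lambda>\<alpha>. m powr (1 / (- \<alpha> - 1)) * mks_load P) \<longlongrightarrow> m powr 0 * mks_load P) at_bot"
      using m by (intro tendsto_intros) auto
    then show "((\<lambda>\<alpha>. m powr (1 / (- \<alpha> - 1)) * mks_load P) \<longlongrightarrow> mks_load P) at_bot" using m by simp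
  qed simp
qed

end
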